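(* For every integer $n \ge 1$ and every connected $n$-vertex graph $G$, there exists a connected graph $F$ with $|V(F)| \leq 3n^2+3n+6$ such that $\mathcal{C}_H(F)\cong G$.
   Context: Graphs are finite, without loops or multiple edges. For a connected graph $F$, $d(u,v)$ denotes the distance (length of a shortest $u$-$v$-path). The harmonic centrality of a vertex $x$ of $F$ is $H_F(x)=\sum_{u\in V(F),\,u\neq x}\frac{1}{d(u,x)}$. The harmonic center $\mathcal{C}_H(F)$ is the subgraph of $F$ induced by the vertices of $F$ with maximum harmonic centrality. *)

theory Defs
  imports Complex_Main "Graph_Theory.Graph_Theory"
begin

text \<open>
  Finite simple undirected graphs are the symmetric digraphs of locale \<^locale>\<open>graph\<close>:
  an undirected edge is a pair of opposite arcs.
\<close>

text \<open>
  Only meaningful if there is a path from \<open>u\<close> to \<open>v\<close>; a path (\<open>apath\<close>) is a list of arcs, so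
  its length is its number of edges.
\<close>
definition graph_dist :: "('a, 'b) pre_digraph \<Rightarrow> 'a \<Rightarrow> 'a \<Rightarrow> nat" where
  "graph_dist F u v = (LEAST k. \<exists>p. pre_digraph.apath F u p v \<and> length p = k)"

definition harmonic_centrality :: "('a, 'b) pre_digraph \<Rightarrow> 'a \<Rightarrow> real" where
  "harmonic_centrality F x = (\<Sum>u\<in>verts F - {x}. 1 / real (graph_dist F u x))"

definition harmonic_center :: "('a, 'b) pre_digraph \<Rightarrow> ('a, 'b) pre_digraph" where
  "harmonic_center F =
     F \<restriction> {x \<in> verts F. \<forall>y \<in> verts F. harmonic_centrality F y \<le> harmonic_centrality F x}"

end

theory Submission
  imports Defs
begin

text \<open>
  In a connected graph with \<open>N\<close> vertices, a vertex contributes \<open>1\<close> to the centrality of \<open>x\<close> if it is a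
  neighbour of \<open>x\<close> and at most \<open>1/2\<close> otherwise.  Hence the centrality of \<open>x\<close> is at most
  \<open>(N - 1 + deg x) / 2\<close>, and this bound is attained when every vertex is within distance two of \<open>x\<close>
  (\<open>harmonic_centrality_le\<close>, \<open>harmonic_centrality_eq\<close>).  So a set \<open>S\<close> of vertices of eccentricity
  at most two, all of the same degree \<open>D\<close>, spans the harmonic center as soon as all other
  vertices have degree below \<open>D\<close> (\<open>harmonic_center_eq_induced\<close>).

  It remains to embed \<open>G\<close> in a larger graph that evens out the degrees in this way.  Let \<open>G\<close> have the
  vertices \<open>0, \<dots>, n - 1\<close> and add \<open>2 * n\<close> new vertices.  Join a vertex \<open>i\<close> of degree \<open>d\<close> in \<open>G\<close> to
  all new vertices but the first \<open>d\<close>, so that its degree becomes \<open>d + (2 * n - d) = 2 * n\<close>.  As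
  \<open>d \<le> n - 1\<close>, the last new vertex, the hub, is joined to all of \<open>G\<close>, and only the first \<open>n - 1\<close> new
  vertices can be missed.  Joining the hub to those brings everything within distance two
  of every vertex of \<open>G\<close>, while each new vertex has at most \<open>n\<close> neighbours in \<open>G\<close> and at most
  \<open>n - 1\<close> new ones, fewer than \<open>2 * n\<close> in total.  The resulting graph has \<open>3 * n\<close> vertices.
\<close>

section \<open>Harmonic centrality and degrees\<close>

definition neighbours :: "('a, 'b) pre_digraph \<Rightarrow> 'a \<Rightarrow> 'a set" where
  "neighbours F x = {u. u \<rightarrow>\<^bsub>F\<^esub> x}"

context wf_digraph
begin

lemma neighbours_subset_verts: "neighbours G x \<subseteq> verts G"
  by (auto simp: neighbours_def)

lemma apath_of_graph_dist:
  assumes "u \<rightarrow>\<^sup>* v"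
  obtains p where "apath u p v" "length p = graph_dist G u v"
proof -
  have "\<exists>k p. apath u p v \<and> length p = k"
    using assms by (simp add: reachable_apath)
  then have "\<exists>p. apath u p v \<and> length p = graph_dist G u v"
    unfolding graph_dist_def by (rule LeastI_ex)
  then show thesis using that by blast
qed

lemma graph_dist_le_length: "apath u p v \<Longrightarrow> graph_dist G u v \<le> length p"
  unfolding graph_dist_def by (rule Least_le) blast

lemma graph_dist_pos:
  assumes "u \<rightarrow>\<^sup>* v" "u \<noteq> v"
  shows "graph_dist G u v \<ge> 1"
proof -
  obtain p where "apath u p v" "length p = graph_dist G u v"
    using assms(1) by (rule apath_of_graph_dist)
  then show ?thesis using assms(2) by (cases p) (auto simp: apath_Nil_iff)
qed

lemma graph_dist_ge_two:
  assumes "u \<rightarrow>\<^sup>* v" "u \<noteq> v" "\<not> u \<rightarrow> v"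
  shows "graph_dist G u v \<ge> 2"
proof -
  obtain p where p: "apath u p v" "length p = graph_dist G u v"
    using assms(1) by (rule apath_of_graph_dist)
  have "length p \<noteq> 1"
  proof
    assume "length p = 1"
    then obtain e where "p = [e]" by (auto simp: length_Suc_conv)
    then have "e \<in> arcs G" "tail G e = u" "head G e = v"
      using p(1) by (auto simp: apath_simps)
    then show False using assms(3) by (auto intro: dominatesI simp: arc_to_ends_def)
  qed
  moreover have "length p \<ge> 1" using graph_dist_pos[OF assms(1,2)] p(2) by simp
  ultimately show ?thesis using p(2) by linarith
qed

lemma graph_dist_adjacent:
  assumes "u \<rightarrow> v" "u \<noteq> v"
  shows "graph_dist G u v = 1"
proof -
  obtain e where "e \<in> arcs G" "tail G e = u" "head G e = v"
    using assms(1) by (auto simp: arcs_ends_def arc_to_ends_def)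
  then have "apath u [e] v" using assms(2) by (auto simp: apath_simps)
  then have "graph_dist G u v \<le> 1" using graph_dist_le_length by fastforce
  with graph_dist_pos[OF reachable_adjI[OF assms(1)] assms(2)] show ?thesis by simp
qed

lemma graph_dist_le_two:
  assumes "u \<rightarrow> w" "w \<rightarrow> v" "u \<noteq> v" "u \<noteq> w" "w \<noteq> v"
  shows "graph_dist G u v \<le> 2"
proof -
  obtain e f where "e \<in> arcs G" "tail G e = u" "head G e = w"
    "f \<in> arcs G" "tail G f = w" "head G f = v"
    using assms(1,2) by (auto simp: arcs_ends_def arc_to_ends_def)
  then have "apath u [e, f] v" using assms(3-) by (auto simp: apath_simps)
  then show ?thesis using graph_dist_le_length by fastforce
qed

end

context graph
begin

text \<open>
  The centrality that \<open>x\<close> would have if all its non-neighbours were at distance exactly two.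
\<close>
lemma sum_neighbour_weights:
  assumes "x \<in> verts G"
  shows "(\<Sum>u\<in>verts G - {x}. if u \<rightarrow> x then 1 else 1 / 2 :: real) =
    (real (card (verts G)) - 1 + real (card (neighbours G x))) / 2"
proof -
  let ?V = "verts G - {x}"
  have "x \<notin> neighbours G x" using adj_not_same by (auto simp: neighbours_def)
  then have V: "{u \<in> ?V. u \<rightarrow> x} = neighbours G x"
    by (auto simp: neighbours_def)
  have "(\<Sum>u\<in>?V. if u \<rightarrow> x then 1 else 1 / 2 :: real) =
      (\<Sum>u\<in>?V. 1 / 2 + (if u \<rightarrow> x then 1 / 2 else 0))"
    by (intro sum.cong) auto
  also have "\<dots> = real (card ?V) / 2 + (\<Sum>u\<in>{u \<in> ?V. u \<rightarrow> x}. 1 / 2)"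
    by (subst sum.inter_filter) (simp_all add: sum.distrib)
  also have "\<dots> = real (card ?V) / 2 + real (card (neighbours G x)) / 2"
    by (simp only: V) simp
  also have "real (card ?V) = real (card (verts G)) - 1"
    using assms card_gt_0_iff[of "verts G"] by (auto simp: of_nat_diff card_Diff_singleton)
  finally show ?thesis by (simp add: add_divide_distrib)
qed

lemma reachable_of_connected:
  assumes "connected G" "u \<in> verts G" "v \<in> verts G"
  shows "u \<rightarrow>\<^sup>* v"
  using symmetric_connected_imp_strongly_connected[OF sym_arcs assms(1)] assms(2,3) by blast

lemma harmonic_centrality_le:
  assumes "connected G" "x \<in> verts G"
  shows "harmonic_centrality G x \<le>
    (real (card (verts G)) - 1 + real (card (neighbours G x))) / 2"
  unfolding harmonic_centrality_def sum_neighbour_weights[OF assms(2), symmetric]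
proof (rule sum_mono)
  fix u assume u: "u \<in> verts G - {x}"
  then have r: "u \<rightarrow>\<^sup>* x" "u \<noteq> x" using reachable_of_connected assms by auto
  show "1 / real (graph_dist G u x) \<le> (if u \<rightarrow> x then 1 else 1 / 2)"
    using graph_dist_adjacent[OF _ r(2)] graph_dist_ge_two[OF r] by (auto simp: field_simps)
qed

lemma harmonic_centrality_eq:
  assumes "connected G" "x \<in> verts G"
    and two: "\<And>u. u \<in> verts G - {x} \<Longrightarrow> u \<rightarrow> x \<or> (\<exists>w. u \<rightarrow> w \<and> w \<rightarrow> x)"
  shows "harmonic_centrality G x =
    (real (card (verts G)) - 1 + real (card (neighbours G x))) / 2"
  unfolding harmonic_centrality_def sum_neighbour_weights[OF assms(2), symmetric]
proof (rule sum.cong)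
  fix u assume u: "u \<in> verts G - {x}"
  then have r: "u \<rightarrow>\<^sup>* x" "u \<noteq> x" using reachable_of_connected assms by auto
  show "1 / real (graph_dist G u x) = (if u \<rightarrow> x then 1 else 1 / 2)"
  proof (cases "u \<rightarrow> x")
    case True
    then show ?thesis using graph_dist_adjacent[OF _ r(2)] by simp
  next
    case False
    then obtain w where w: "u \<rightarrow> w" "w \<rightarrow> x" using two[OF u] by blast
    then have "u \<noteq> w" "w \<noteq> x" using adj_not_same by auto
    then have "graph_dist G u x = 2"
      using graph_dist_le_two[OF w r(2)] graph_dist_ge_two[OF r False] by simp
    then show ?thesis using False by simp
  qed
qed simp

text \<open>A single vertex of eccentricity at most two already links all vertices to each other.\<close>
lemma connected_of_eccentricity_le_two:
  assumes "x \<in> verts G"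
    and two: "\<And>u. u \<in> verts G - {x} \<Longrightarrow> u \<rightarrow> x \<or> (\<exists>w. u \<rightarrow> w \<and> w \<rightarrow> x)"
  shows "connected G"
proof -
  have to_x: "u \<rightarrow>\<^sup>* x" if "u \<in> verts G" for u
    using that assms(1) two[of u] by (cases "u = x") (auto intro: reachable_adj_trans)
  show ?thesis
  proof (rule connectedI)
    show "u \<rightarrow>\<^sup>*\<^bsub>mk_symmetric G\<^esub> v" if "u \<in> verts G" "v \<in> verts G" for u v
      using to_x[OF that(1)] symmetric_reachable[OF sym_arcs to_x[OF that(2)]]
      by (intro reachable_mk_symmetricI) (rule reachable_trans)
  qed (use assms(1) in auto)
qed

lemma harmonic_center_eq_induced:
  assumes "connected G" "S \<subseteq> verts G" "S \<noteq> {}"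
    and degS: "\<And>x. x \<in> S \<Longrightarrow> card (neighbours G x) = D"
    and deg: "\<And>x. x \<in> verts G - S \<Longrightarrow> card (neighbours G x) < D"
    and two: "\<And>x u. x \<in> S \<Longrightarrow> u \<in> verts G - {x} \<Longrightarrow> u \<rightarrow> x \<or> (\<exists>w. u \<rightarrow> w \<and> w \<rightarrow> x)"
  shows "harmonic_center G = G \<restriction> S"
proof -
  define M where "M = (real (card (verts G)) - 1 + real D) / 2"
  have S: "harmonic_centrality G x = M" if "x \<in> S" for x
    unfolding M_def using harmonic_centrality_eq[OF assms(1) _ two[OF that]] that assms(2) degS
    by auto
  have not_S: "harmonic_centrality G x < M" if "x \<in> verts G - S" for x
    using harmonic_centrality_le[OF assms(1), of x] deg[OF that] that unfolding M_def by auto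
  have le: "harmonic_centrality G x \<le> M" if "x \<in> verts G" for x
    using S[of x] not_S[of x] that by (cases "x \<in> S") auto
  obtain s where s: "s \<in> S" using assms(3) by blast
  have "{x \<in> verts G. \<forall>y \<in> verts G. harmonic_centrality G y \<le> harmonic_centrality G x} = S"
    (is "?C = S")
  proof
    show "S \<subseteq> ?C" using S le assms(2) by auto
    show "?C \<subseteq> S"
    proof
      fix x assume "x \<in> ?C"
      then have "x \<in> verts G" "M \<le> harmonic_centrality G x" using s S assms(2) by auto
      then show "x \<in> S" using not_S[of x] by force
    qed
  qed
  then show ?thesis unfolding harmonic_center_def by simp
qed

end

section \<open>Evening out the degrees\<close>

locale simple_graph_relation =
  fixes n :: nat and E :: "nat \<Rightarrow> nat \<Rightarrow> bool"
  assumes sym: "E i j \<Longrightarrow> E j i" and irrefl: "\<not> E i i" and nonempty: "n \<ge> 1"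
begin

definition deg :: "nat \<Rightarrow> nat" where
  "deg i = card {j. j < n \<and> E j i}"

text \<open>
  The new vertices are \<open>n, \<dots>, 3 * n - 1\<close>, the last one being the hub.  Each edge is listed in one
  orientation only.
\<close>
definition new_edge :: "nat \<Rightarrow> nat \<Rightarrow> bool" where
  "new_edge i j \<longleftrightarrow> i < n \<and> n + deg i \<le> j \<and> j < 3 * n \<or> n \<le> i \<and> i < 2 * n - 1 \<and> j = 3 * n - 1"

definition adj :: "nat \<Rightarrow> nat \<Rightarrow> bool" where
  "adj i j \<longleftrightarrow> i < n \<and> j < n \<and> E i j \<or> new_edge i j \<or> new_edge j i"

definition F :: "(nat, nat \<times> nat) pre_digraph" where
  "F = \<lparr>verts = {..<3 * n}, arcs = {(i, j). adj i j}, tail = fst, head = snd\<rparr>"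

lemma deg_less:
  assumes "i < n"
  shows "deg i < n"
proof -
  have "{j. j < n \<and> E j i} \<subset> {..<n}" using irrefl assms by auto
  then have "deg i < card {..<n}" unfolding deg_def by (rule psubset_card_mono[rotated]) simp
  then show ?thesis by simp
qed

lemma adj_sym: "adj i j \<Longrightarrow> adj j i"
  using sym by (auto simp: adj_def)

lemma adj_less: "adj i j \<Longrightarrow> i < 3 * n \<and> j < 3 * n"
  by (auto simp: adj_def new_edge_def)

lemma adj_irrefl: "\<not> adj i i"
  using irrefl by (auto simp: adj_def new_edge_def)

lemma F_simps [simp]:
  "verts F = {..<3 * n}" "arcs F = {(i, j). adj i j}" "tail F = fst" "head F = snd"
  by (simp_all add: F_def)

lemma F_dominates [simp]: "i \<rightarrow>\<^bsub>F\<^esub> j \<longleftrightarrow> adj i j"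
  by (force simp: arcs_ends_def arc_to_ends_def)

lemma graph_F: "graph F"
proof -
  have "finite {(i, j). adj i j}"
    by (rule finite_subset[of _ "{..<3 * n} \<times> {..<3 * n}"]) (auto dest: adj_less)
  moreover have "symmetric F"
    unfolding symmetric_def by (auto intro!: symI adj_sym)
  ultimately show ?thesis
    by unfold_locales (auto simp: arc_to_ends_def adj_irrefl dest: adj_less)
qed

sublocale F: graph F
  by (rule graph_F)

lemma degree_old_vertex:
  assumes "i < n"
  shows "card (neighbours F i) = 2 * n"
proof -
  have "neighbours F i = {j. j < n \<and> E j i} \<union> {n + deg i..<3 * n}"
    using assms by (auto simp: neighbours_def adj_def new_edge_def)
  then have "card (neighbours F i) = deg i + card {n + deg i..<3 * n}"
    by (simp add: deg_def card_Un_disjoint disjoint_iff)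
  then show ?thesis using deg_less[OF assms] by simp
qed

lemma degree_new_vertex:
  assumes "n \<le> i"
  shows "card (neighbours F i) < 2 * n"
proof -
  define W where "W = (if i = 3 * n - 1 then {n..<2 * n - 1} else if i < 2 * n - 1 then {3 * n - 1} else {})"
  have "neighbours F i \<subseteq> {..<n} \<union> W"
    using assms nonempty by (auto simp: neighbours_def adj_def new_edge_def W_def)
  moreover have "finite W" by (simp add: W_def)
  ultimately have "card (neighbours F i) \<le> card {..<n} + card W"
    by (meson card_Un_le card_mono finite_UnI finite_lessThan le_trans)
  moreover have "card W \<le> n - 1" using assms by (auto simp: W_def)
  ultimately show ?thesis using nonempty by simp
qed

text \<open>The hub is the common neighbour: a vertex not joined to it is joined to all vertices below \<open>n\<close>.\<close>
lemma old_vertex_eccentricity: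
  assumes "i < n" "j \<in> verts F - {i}"
  shows "j \<rightarrow>\<^bsub>F\<^esub> i \<or> (\<exists>w. j \<rightarrow>\<^bsub>F\<^esub> w \<and> w \<rightarrow>\<^bsub>F\<^esub> i)"
proof (cases "adj j i")
  case False
  have hub: "adj k (3 * n - 1)" if "k < n" for k
    using deg_less[OF that] that by (auto simp: adj_def new_edge_def)
  have "adj j (3 * n - 1)"
  proof (cases "j < n")
    case False
    \<comment> \<open>A new vertex not joined to \<open>i\<close> is one of the first \<open>deg i \<le> n - 1\<close>.\<close>
    then have "j < n + deg i" using \<open>\<not> adj j i\<close> assms by (auto simp: adj_def new_edge_def)
    then show ?thesis using False deg_less[OF assms(1)] by (auto simp: adj_def new_edge_def)
  qed (rule hub)
  then show ?thesis using hub[OF assms(1)] adj_sym by auto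
qed simp

lemma connected_F: "connected F"
  using nonempty old_vertex_eccentricity[of 0] by (intro F.connected_of_eccentricity_le_two[of 0]) auto

lemma harmonic_center_F: "harmonic_center F = F \<restriction> {..<n}"
  by (rule F.harmonic_center_eq_induced[OF connected_F])
    (use nonempty in \<open>auto simp: degree_old_vertex degree_new_vertex lessThan_empty_iff
      dest: old_vertex_eccentricity\<close>)

end

section \<open>Transfer along a numbering of the vertices\<close>

text \<open>
  Numbering the vertices determines the isomorphism: without parallel arcs, an arc is
  recovered from its pair of end points.
\<close>
lemma (in nomulti_digraph) digraph_iso_numbered:
  assumes f: "bij_betw f (verts G) (verts H)"
    and "arcs H = (\<lambda>(u, v). (f u, f v)) ` arcs_ends G" "tail H = fst" "head H = snd"
  shows "digraph_iso H G"
proof -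
  define h where "h = \<lparr>iso_verts = f, iso_arcs = (\<lambda>a. (f (tail G a), f (head G a))),
    iso_head = snd, iso_tail = fst\<rparr>"
  have inj: "inj_on f (verts G)" using f by (rule bij_betw_imp_inj_on)
  have "inj_on (iso_arcs h) (arcs G)"
    by (rule inj_onI, rule no_multi_arcs)
      (auto simp: h_def arc_to_ends_def dest: inj_onD[OF inj])
  then have "digraph_isomorphism h"
    unfolding digraph_isomorphism_def using inj wf_digraph_axioms by (auto simp: h_def)
  moreover have "app_iso h G = H"
    using assms
    by (intro pre_digraph.equality) (auto simp: h_def bij_betw_def arcs_ends_def arc_to_ends_def image_image)
  ultimately have "digraph_iso G H" unfolding digraph_iso_def by blast
  then show ?thesis using digraph_iso_swap wf_digraph_axioms by blast
qed

theorem theorem1: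
  fixes G :: "('a, 'b) pre_digraph" and n :: nat
  assumes "n \<ge> 1"
    and "graph G" and "connected G" and "card (verts G) = n"
  shows "\<exists>F :: (nat, nat \<times> nat) pre_digraph.
           graph F \<and> connected F \<and> card (verts F) \<le> 3 * n^2 + 3 * n + 6 \<and>
           digraph_iso (harmonic_center F) G"
proof -
  interpret G: graph G by (rule assms(2))
  obtain f where f: "bij_betw f (verts G) {0..<n}"
    using ex_bij_betw_finite_nat[OF G.finite_verts] assms(4) by blast
  define E where "E i j \<longleftrightarrow> (i, j) \<in> (\<lambda>(u, v). (f u, f v)) ` arcs_ends G" for i j
  interpret simple_graph_relation n E
  proof
    show "E j i" if "E i j" for i j
      using that G.sym_arcs unfolding E_def symmetric_def by (force dest: symD)
    show "\<not> E i i" for i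
    proof
      assume "E i i"
      then obtain u v where "u \<rightarrow>\<^bsub>G\<^esub> v" "f u = f v" by (auto simp: E_def)
      moreover from this have "u = v"
        using inj_onD[OF bij_betw_imp_inj_on[OF f]] G.adj_in_verts by blast
      ultimately show False using G.adj_not_same by blast
    qed
  qed (rule assms(1))
  have E_less: "i < n \<and> j < n" if "E i j" for i j
    using that bij_betw_imp_surj_on[OF f] by (force simp: E_def)
  have "digraph_iso (F \<restriction> {..<n}) G"
  proof (rule G.digraph_iso_numbered)
    show "bij_betw f (verts G) (verts (F \<restriction> {..<n}))"
      using f by (simp add: lessThan_atLeast0)
    have "arcs (F \<restriction> {..<n}) = {(i, j). E i j}"
      using E_less by (auto simp: adj_def new_edge_def)
    then show "arcs (F \<restriction> {..<n}) = (\<lambda>(u, v). (f u, f v)) ` arcs_ends G"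
      by (auto simp: E_def)
  qed simp_all
  moreover have "card (verts F) \<le> 3 * n^2 + 3 * n + 6" by simp
  ultimately show ?thesis using graph_F connected_F harmonic_center_F by metis
qed

end
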